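(* Assume the Continuum Hypothesis. Let $X$ be a sequential $k_\omega$-space. Then $X$ is first countable at a dense subset of points if and only if the set of non-$k$-points of $X$ has empty interior.
   Context: A $k_\omega$-space is a Hausdorff space which is the image of a locally compact, $\sigma$-compact Hausdorff space under a quotient map. A point $x$ of a topological space $X$ is a $k$-point if whenever $E\subseteq X$ and $x\in\overline E$, there is a compact set $K\subseteq X$ such that $x\in\overline{E\cap K}$; otherwise it is a non-$k$-point. A space is sequential if every sequentially closed subset is closed. *)

theory Defs
  imports "HOL-Analysis.Analysis" "HOL-Library.Equipollence"
begin

definition continuum_hypothesis :: bool where
  "continuum_hypothesis \<longleftrightarrow> (\<forall>A :: real set. countable A \<or> A \<approx> (UNIV :: real set))"

definition sigma_compact_space :: "'a topology \<Rightarrow> bool" where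
  "sigma_compact_space X \<longleftrightarrow>
     (\<exists>\<K>. countable \<K> \<and> (\<forall>K \<in> \<K>. compactin X K) \<and> \<Union>\<K> = topspace X)"

text \<open>
  HOL cannot quantify existentially over types, so the type of points of the space mapped onto
  \<open>X\<close> is a parameter of the definition. If \<open>'b\<close> is left as a free type variable in
  a theorem that has \<open>k_omega_space TYPE('b) X\<close> as a hypothesis, the theorem covers
  preimage spaces on an arbitrary type.
\<close>

definition k_omega_space :: "'b itself \<Rightarrow> 'a topology \<Rightarrow> bool" where
  "k_omega_space (_ :: 'b itself) X \<longleftrightarrow>
     Hausdorff_space X \<and>
     (\<exists>(Y :: 'b topology) q.
        locally_compact_space Y \<and> sigma_compact_space Y \<and> Hausdorff_space Y \<and>
        quotient_map Y X q)"

definition k_point :: "'a topology \<Rightarrow> 'a \<Rightarrow> bool" where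
  "k_point X x \<longleftrightarrow>
     x \<in> topspace X \<and>
     (\<forall>E. E \<subseteq> topspace X \<and> x \<in> X closure_of E \<longrightarrow>
          (\<exists>K. compactin X K \<and> x \<in> X closure_of (E \<inter> K)))"

definition non_k_points :: "'a topology \<Rightarrow> 'a set" where
  "non_k_points X = {x \<in> topspace X. \<not> k_point X x}"

definition sequentially_closedin :: "'a topology \<Rightarrow> 'a set \<Rightarrow> bool" where
  "sequentially_closedin X A \<longleftrightarrow>
     A \<subseteq> topspace X \<and>
     (\<forall>\<sigma> l. range \<sigma> \<subseteq> A \<and> limitin X \<sigma> l sequentially \<longrightarrow> l \<in> A)"

definition sequential_space :: "'a topology \<Rightarrow> bool" where
  "sequential_space X \<longleftrightarrow> (\<forall>A. sequentially_closedin X A \<longrightarrow> closedin X A)"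

text \<open>The pointwise version of \<^const>\<open>first_countable\<close>.\<close>

definition first_countable_at :: "'a topology \<Rightarrow> 'a \<Rightarrow> bool" where
  "first_countable_at X x \<longleftrightarrow>
     x \<in> topspace X \<and>
     (\<exists>\<B>. countable \<B> \<and> (\<forall>V \<in> \<B>. openin X V) \<and>
          (\<forall>U. openin X U \<and> x \<in> U \<longrightarrow> (\<exists>V \<in> \<B>. x \<in> V \<and> V \<subseteq> U)))"

end

theory Submission
  imports Defs
begin

text \<open>
  A point of first countability is a \<open>k\<close>-point, since a convergent sequence together with its limit
  is compact; this gives one direction.

  For the converse, a \<open>k\<^sub>\<omega>\<close>-space \<open>X\<close> is an increasing union of compact sets \<open>K n\<close> such that every
  compact set lies in some \<open>K n\<close>. If a nonempty open \<open>U\<close> misses the interior of every \<open>K n\<close>, then every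
  \<open>x \<in> U\<close> is a limit of points \<open>\<sigma> n \<noteq> x\<close>, each of which is adherent to the complement of \<open>K n\<close>; a
  union of pieces of these complements near \<open>\<sigma> n\<close> shows that \<open>x\<close> is not a \<open>k\<close>-point. So if the
  non-\<open>k\<close>-points have empty interior, every such \<open>U\<close> meets the interior of some \<open>K n\<close>, and it remains
  to find a \<open>G\<^sub>\<delta>\<close>-point in each nonempty open subset of a compact sequential Hausdorff space. Otherwise a
  tree of closed \<open>G\<^sub>\<delta>\<close>-sets of height \<open>\<omega>\<^sub>1\<close> can be built as in the Cech-Pospisil theorem. Under CH it has only
  continuum many nodes, and by sequentiality the closure of a set of continuum many points, one from each
  node, again has only continuum many points; but it meets all the pairwise disjoint branches,
  and there are more than continuum many of those.
\<close>

subsection \<open>Points of first countability\<close>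

text \<open>Finite intersections turn an enumerated local base into a decreasing one. Then all late
  \<open>W n\<close> lie in a given neighbourhood, so any choice of points from the
  \<open>W n\<close> converges to \<open>x\<close>.\<close>

lemma first_countable_at_descending:
  assumes "first_countable_at X x"
  obtains W where "\<And>n::nat. openin X (W n)" "\<And>n. x \<in> W n"
    "\<And>U. openin X U \<Longrightarrow> x \<in> U \<Longrightarrow> \<exists>N. \<forall>n\<ge>N. W n \<subseteq> U"
proof -
  obtain \<B> where x: "x \<in> topspace X" and \<B>: "countable \<B>" "\<forall>V \<in> \<B>. openin X V"
      "\<forall>U. openin X U \<and> x \<in> U \<longrightarrow> (\<exists>V \<in> \<B>. x \<in> V \<and> V \<subseteq> U)"
    using assms unfolding first_countable_at_def by (elim conjE exE)
  define \<C> where "\<C> = {V \<in> \<B>. x \<in> V}"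
  have "countable \<C>" "\<C> \<noteq> {}"
    using \<B>(1) \<B>(3) x openin_topspace by (auto simp: \<C>_def)
  define b where "b = from_nat_into \<C>"
  have b: "range b = \<C>"
    unfolding b_def using \<open>\<C> \<noteq> {}\<close> \<open>countable \<C>\<close> by (rule range_from_nat_into)
  then have bC: "b i \<in> \<B>" "x \<in> b i" for i
    by (auto simp: \<C>_def)
  define W where "W n = (\<Inter>i\<le>n. b i)" for n :: nat
  show thesis
  proof
    show "openin X (W n)" for n
      unfolding W_def using bC \<B>(2) by (intro openin_INT2) auto
    show "x \<in> W n" for n
      unfolding W_def using bC by auto
    show "\<exists>N. \<forall>n\<ge>N. W n \<subseteq> U" if U: "openin X U" "x \<in> U" for U
    proof -
      obtain V where "V \<in> \<C>" "V \<subseteq> U"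
        using \<B>(3) U by (auto simp: \<C>_def)
      then obtain N where "b N \<subseteq> U"
        unfolding b[symmetric] by (elim imageE) simp
      moreover have "W n \<subseteq> b N" if "n \<ge> N" for n
        unfolding W_def using that by blast
      ultimately show ?thesis
        by blast
    qed
  qed
qed

lemma first_countable_at_imp_k_point:
  assumes "first_countable_at X x"
  shows "k_point X x"
  unfolding k_point_def
proof (intro conjI allI impI)
  show x: "x \<in> topspace X"
    using assms by (simp add: first_countable_at_def)
  fix E
  assume E: "E \<subseteq> topspace X \<and> x \<in> X closure_of E"
  obtain W where W: "\<And>n::nat. openin X (W n)" "\<And>n. x \<in> W n"
    "\<And>U. openin X U \<Longrightarrow> x \<in> U \<Longrightarrow> \<exists>N. \<forall>n\<ge>N. W n \<subseteq> U"
    using first_countable_at_descending[OF assms] by blast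
  have "\<exists>y. y \<in> E \<inter> W n" for n
    using E W(1,2)[of n] by (auto simp: in_closure_of)
  then obtain \<sigma> where \<sigma>: "\<And>n. \<sigma> n \<in> E \<inter> W n"
    by metis
  have ev: "\<exists>N. \<forall>n\<ge>N. \<sigma> n \<in> U" if "openin X U" "x \<in> U" for U
    using W(3)[OF that] \<sigma> by blast
  then have lim: "limitin X \<sigma> x sequentially"
    using x by (simp add: limitin_sequentially)
  have "range \<sigma> \<subseteq> topspace X"
    using \<sigma> E by blast
  then have "compactin X (insert x (range \<sigma>))"
    by (rule compactin_sequence_with_limit[OF lim order_refl])
  moreover have "x \<in> X closure_of (E \<inter> insert x (range \<sigma>))"
    unfolding in_closure_of
  proof (intro conjI allI impI x)
    fix T assume "x \<in> T \<and> openin X T"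
    then obtain n where "\<sigma> n \<in> T"
      using ev by blast
    then show "\<exists>y. y \<in> E \<inter> insert x (range \<sigma>) \<and> y \<in> T"
      using \<sigma> by blast
  qed
  ultimately show "\<exists>K. compactin X K \<and> x \<in> X closure_of (E \<inter> K)"
    by blast
qed

text \<open>Sets relatively open in \<open>K\<close> need not be open in \<open>X\<close>, but their
  traces on the open set \<open>V \<subseteq> K\<close> are. This carries points of first
  countability from a compact piece over to the whole space.\<close>

lemma first_countable_at_subtopology_imp:
  assumes "first_countable_at (subtopology X K) p" "openin X V" "V \<subseteq> K" "p \<in> V"
  shows "first_countable_at X p"
proof -
  obtain \<B> where \<B>: "countable \<B>" "\<forall>B \<in> \<B>. openin (subtopology X K) B"
    and base: "\<forall>U. openin (subtopology X K) U \<and> p \<in> U \<longrightarrow> (\<exists>B \<in> \<B>. p \<in> B \<and> B \<subseteq> U)"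
    using assms(1) unfolding first_countable_at_def by (elim conjE exE)
  show ?thesis
    unfolding first_countable_at_def
  proof (intro conjI exI[of _ "(\<lambda>B. B \<inter> V) ` \<B>"])
    show "p \<in> topspace X"
      using assms openin_subset by blast
    show "countable ((\<lambda>B. B \<inter> V) ` \<B>)"
      using \<B> by simp
    show "\<forall>W\<in>(\<lambda>B. B \<inter> V) ` \<B>. openin X W"
    proof clarify
      fix B assume "B \<in> \<B>"
      then obtain T where "openin X T" "B = T \<inter> K"
        using \<B>(2) by (auto simp: openin_subtopology)
      then have "B \<inter> V = T \<inter> V"
        using \<open>V \<subseteq> K\<close> by blast
      then show "openin X (B \<inter> V)"
        using \<open>openin X T\<close> assms(2) by (simp only: openin_Int)
    qed
    show "\<forall>U. openin X U \<and> p \<in> U \<longrightarrow> (\<exists>W\<in>(\<lambda>B. B \<inter> V) ` \<B>. p \<in> W \<and> W \<subseteq> U)"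
    proof clarify
      fix U assume "openin X U" "p \<in> U"
      then have "openin (subtopology X K) (U \<inter> K) \<and> p \<in> U \<inter> K"
        using assms by (auto intro: openin_subtopology_Int)
      from base[rule_format, OF this] obtain B where "B \<in> \<B>" "p \<in> B \<and> B \<subseteq> U \<inter> K" ..
      then show "\<exists>W\<in>(\<lambda>B. B \<inter> V) ` \<B>. p \<in> W \<and> W \<subseteq> U"
        using \<open>p \<in> V\<close> by (intro bexI[of _ "B \<inter> V"]) auto
    qed
  qed
qed

text \<open>A sequence in a closed set keeps its limits there, so a subset sequentially closed in
  \<open>K\<close> is sequentially closed in \<open>X\<close>.\<close>

lemma sequential_space_closed_subtopology:
  assumes "sequential_space X" "closedin X K"
  shows "sequential_space (subtopology X K)"
  unfolding sequential_space_def
proof (intro allI impI)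
  fix A assume A: "sequentially_closedin (subtopology X K) A"
  then have AK: "A \<subseteq> topspace X \<inter> K"
    by (simp add: sequentially_closedin_def)
  have "sequentially_closedin X A"
    unfolding sequentially_closedin_def
  proof (intro conjI allI impI)
    fix \<sigma> l assume \<sigma>: "range \<sigma> \<subseteq> A \<and> limitin X \<sigma> l sequentially"
    have \<sigma>K: "\<sigma> n \<in> K" "\<sigma> n \<in> topspace X" for n
      using \<sigma> AK by auto
    then have "l \<in> K"
      using \<sigma> by (intro limitin_closedin[OF _ assms(2), of \<sigma> l sequentially]) auto
    then have "limitin (subtopology X K) \<sigma> l sequentially"
      using \<sigma> \<sigma>K unfolding limitin_subtopology by auto
    then show "l \<in> A"
      using A \<sigma> by (auto simp: sequentially_closedin_def)
  qed (use AK in auto)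
  then have "closedin X A"
    using assms(1) by (simp add: sequential_space_def)
  then show "closedin (subtopology X K) A"
    using AK by (metis closedin_subset_topspace le_inf_iff)
qed

section \<open>Chains of closed sets and \<open>G\<^sub>\<delta>\<close>-points in compact Hausdorff
  spaces\<close>

lemma Inter_in_finite_chain:
  assumes "finite \<F>" "\<F> \<noteq> {}" "\<And>A B. A \<in> \<F> \<Longrightarrow> B \<in> \<F> \<Longrightarrow> A \<subseteq> B \<or> B \<subseteq> A"
  shows "\<Inter>\<F> \<in> \<F>"
  using assms
proof (induction \<F> rule: finite_ne_induct)
  case (insert A \<F>)
  then have "A \<subseteq> \<Inter>\<F> \<or> \<Inter>\<F> \<subseteq> A" "\<Inter>\<F> \<in> \<F>"
    by blast+
  then show ?case
    by (metis Inter_insert inf.absorb1 inf.absorb2 insertCI)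
qed auto

text \<open>A finite nonempty subfamily of a chain has its smallest member as intersection, so the
  chain has the finite intersection property.\<close>

lemma compact_space_chain_Inter_nonempty:
  assumes "compact_space X" "\<And>F. F \<in> \<F> \<Longrightarrow> closedin X F \<and> F \<noteq> {}"
    and "\<And>A B. A \<in> \<F> \<Longrightarrow> B \<in> \<F> \<Longrightarrow> A \<subseteq> B \<or> B \<subseteq> A"
  shows "\<Inter>\<F> \<noteq> {}"
proof -
  have "\<Inter>\<G> \<noteq> {}" if "finite \<G>" "\<G> \<subseteq> \<F>" for \<G>
  proof (cases "\<G> = {}")
    case False
    then have "\<Inter>\<G> \<in> \<G>"
      using that assms(3) by (intro Inter_in_finite_chain) auto
    then show ?thesis
      using that assms(2) by blast
  qed simp
  with assms(1,2) show ?thesis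
    unfolding compact_space_fip by simp
qed

lemma gdelta_in_level_set:
  assumes "continuous_map X euclideanreal f"
  shows "gdelta_in X {x \<in> topspace X. f x = c}"
proof -
  have "{x \<in> topspace X. f x = c} = (\<Inter>n::nat. {x \<in> topspace X. f x \<in> ball c (1 / Suc n)})"
  proof -
    have "f x = c" if "\<And>n::nat. f x \<in> ball c (1 / Suc n)" for x
    proof (rule ccontr)
      assume "f x \<noteq> c"
      then obtain n where "1 / real (Suc n) < dist c (f x)"
        by (metis inverse_eq_divide reals_Archimedean zero_less_dist_iff)
      with that[of n] show False
        by simp
    qed
    then show ?thesis by auto
  qed
  moreover have "gdelta_in X (\<Inter>n::nat. {x \<in> topspace X. f x \<in> ball c (1 / Suc n)})"
    using openin_continuous_map_preimage[OF assms, of "ball c (1 / real (Suc n))" for n]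
    by (intro gdelta_in_Inter) (auto intro!: open_imp_gdelta_in simp del: of_nat_Suc mem_ball)
  ultimately show ?thesis
    by (simp only:)
qed

lemma compact_Hausdorff_separate_by_function:
  assumes "compact_space X" "Hausdorff_space X" "openin X V" "p \<in> V"
  obtains f where "continuous_map X euclideanreal f" "f p = 0" "\<And>x. x \<in> topspace X - V \<Longrightarrow> f x = (1::real)"
proof -
  have "completely_regular_space X"
    using assms by (simp add: compact_Hausdorff_or_regular_imp_normal_space normal_imp_completely_regular_space)
  moreover have "closedin X (topspace X - V)" "p \<in> topspace X - (topspace X - V)"
    using assms openin_subset by blast+
  ultimately obtain f where "continuous_map X (top_of_set {0..1}) f" "f p = (0::real)" "f ` (topspace X - V) \<subseteq> {1}"
    unfolding completely_regular_space_def by blast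
  then show ?thesis
    using that[of f] continuous_map_in_subtopology by blast
qed

text \<open>Shrink the open sets \<open>C n\<close> with intersection \<open>{p}\<close> to closed
  neighbourhoods \<open>D n\<close> of \<open>p\<close>. By compactness finitely many
  \<open>D n\<close> already fit into a given open neighbourhood of \<open>p\<close>, so finite
  intersections of the \<open>V n\<close> form a local base.\<close>

lemma gdelta_singleton_imp_first_countable_at:
  assumes "compact_space X" "Hausdorff_space X" "gdelta_in X {p}"
  shows "first_countable_at X p"
proof -
  have p: "p \<in> topspace X"
    using assms(3) gdelta_in_subset by fastforce
  obtain C where C: "\<And>n::nat. openin X (C n)" "\<Inter>(range C) = {p}"
    using assms(3) unfolding gdelta_in_descending by blast
  have pC: "p \<in> C n" for n
    using C(2) by auto
  have reg: "neighbourhood_base_of (closedin X) X"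
    using assms compact_Hausdorff_imp_regular_space by (simp add: neighbourhood_base_of_closedin)
  have "\<exists>V D. openin X V \<and> closedin X D \<and> p \<in> V \<and> V \<subseteq> D \<and> D \<subseteq> C n" for n
    using reg C(1) pC by (simp add: neighbourhood_base_of)
  then obtain V D where VD: "\<And>n. openin X (V n)" "\<And>n. closedin X (D n)" "\<And>n. p \<in> V n"
    "\<And>n. V n \<subseteq> D n" "\<And>n. D n \<subseteq> C n"
    by metis
  show ?thesis
    unfolding first_countable_at_def
  \<comment> \<open>For \<open>N = {}\<close> the intersection over \<open>N\<close> is
    \<open>UNIV\<close>; the factor \<open>topspace X\<close> keeps the set open in
    \<open>X\<close>.\<close>
  proof (intro conjI exI[of _ "(\<lambda>N. topspace X \<inter> (\<Inter>n\<in>N. V n)) ` {N. finite N}"])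
    show "countable ((\<lambda>N. topspace X \<inter> (\<Inter>n\<in>N. V n)) ` {N. finite N})"
      by (simp add: countable_Collect_finite)
    show "\<forall>W\<in>(\<lambda>N. topspace X \<inter> (\<Inter>n\<in>N. V n)) ` {N. finite N}. openin X W"
    proof clarify
      fix N :: "nat set" assume "finite N"
      then have "openin X (topspace X \<inter> \<Inter>(V ` N))"
        using VD(1) by (intro openin_Int_Inter) auto
      then show "openin X (topspace X \<inter> (\<Inter>n\<in>N. V n))" .
    qed
    show "\<forall>U. openin X U \<and> p \<in> U \<longrightarrow>
           (\<exists>W\<in>(\<lambda>N. topspace X \<inter> (\<Inter>n\<in>N. V n)) ` {N. finite N}. p \<in> W \<and> W \<subseteq> U)"
    proof clarify
      fix U assume U: "openin X U" "p \<in> U"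
      let ?F = "insert (topspace X - U) (range D)"
      have "\<Inter>?F = {}"
      proof -
        have "\<Inter>(range D) \<subseteq> {p}"
          unfolding C(2)[symmetric] using VD(5) by (intro INF_mono) auto
        then show ?thesis
          using U(2) by auto
      qed
      moreover have "closedin X F" if "F \<in> ?F" for F
        using that VD(2) U(1) by (elim insertE imageE) auto
      ultimately obtain \<G> where \<G>: "finite \<G>" "\<G> \<subseteq> ?F" "\<Inter>\<G> = {}"
        using assms(1) unfolding compact_space_fip by meson
      then have "finite (\<G> - {topspace X - U})" "\<G> - {topspace X - U} \<subseteq> range D"
        by auto
      then obtain N where N: "finite N" "\<G> - {topspace X - U} = D ` N"
        by (metis finite_subset_image)
      have "topspace X \<inter> (\<Inter>n\<in>N. V n) \<subseteq> U"
      proof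
        fix y assume y: "y \<in> topspace X \<inter> (\<Inter>n\<in>N. V n)"
        then have "y \<in> \<Inter>(\<G> - {topspace X - U})"
          unfolding N using VD(4) by blast
        with \<G>(3) y show "y \<in> U"
          by blast
      qed
      moreover have "p \<in> topspace X \<inter> (\<Inter>n\<in>N. V n)"
        using VD(3) p by blast
      ultimately show "\<exists>W\<in>(\<lambda>N. topspace X \<inter> (\<Inter>n\<in>N. V n)) ` {N. finite N}. p \<in> W \<and> W \<subseteq> U"
        using N(1) by blast
    qed
  qed (use p in auto)
qed

subsection \<open>Exhaustion by compact sets\<close>

lemma locally_compact_sigma_compact_cover:
  assumes "locally_compact_space Y" "sigma_compact_space Y" "Hausdorff_space Y"
  obtains U L where "\<And>n::nat. openin Y (U n)" "\<And>n. compactin Y (L n)" "\<And>n. U n \<subseteq> L n"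
    "(\<Union>n. U n) = topspace Y"
proof -
  obtain \<K> where \<K>: "countable \<K>" "\<forall>K \<in> \<K>. compactin Y K" "\<Union>\<K> = topspace Y"
    using assms(2) unfolding sigma_compact_space_def by (elim exE conjE)
  \<comment> \<open>Adding \<open>{}\<close> allows an enumeration even when \<open>\<K>\<close> is
    empty.\<close>
  define c where "c = from_nat_into (insert {} \<K>)"
  have c: "range c = insert {} \<K>"
    unfolding c_def using \<K>(1) by (intro range_from_nat_into) auto
  have "c n \<in> insert {} \<K>" for n
    using c by auto
  then have cc: "compactin Y (c n)" for n
    using \<K>(2) by (metis compactin_empty insert_iff)
  have "\<exists>U L. openin Y U \<and> compactin Y L \<and> c n \<subseteq> U \<and> U \<subseteq> L" for n
    using assms(1,3) cc[of n] by (force simp: locally_compact_space_compact_closed_compact)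
  then obtain U L where UL: "\<And>n. openin Y (U n) \<and> compactin Y (L n) \<and> c n \<subseteq> U n \<and> U n \<subseteq> L n"
    by metis
  have "topspace Y = \<Union>(range c)"
    unfolding c using \<K>(3) by simp
  also have "\<dots> \<subseteq> (\<Union>n. U n)"
    using UL by (intro SUP_mono) auto
  finally have "topspace Y \<subseteq> (\<Union>n. U n)" .
  moreover have "U n \<subseteq> topspace Y" for n
    using UL openin_subset by metis
  ultimately have "(\<Union>n. U n) = topspace Y"
    by (intro equalityI UN_least) auto
  with UL show thesis
    by (intro that[of U L]) auto
qed

text \<open>The \<open>K n\<close> are finite unions of images of compact sets whose subsets
  \<open>U n\<close> form an open cover upstairs. A compact set contained in no \<open>K n\<close>
  would contain an infinite set meeting each \<open>K n\<close> in a finite set; all subsets of such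
  a set are closed, against Bolzano-Weierstrass.\<close>

lemma k_omega_space_hemicompact:
  assumes "k_omega_space TYPE('b) X"
  obtains K where "\<And>n::nat. compactin X (K n)" "incseq K" "(\<Union>n. K n) = topspace X"
    "\<And>C. compactin X C \<Longrightarrow> \<exists>n. C \<subseteq> K n"
proof -
  obtain Y :: "'b topology" and q where HX: "Hausdorff_space X" and
    Y: "locally_compact_space Y" "sigma_compact_space Y" "Hausdorff_space Y" and q: "quotient_map Y X q"
    using assms unfolding k_omega_space_def by (elim exE conjE)
  have cq: "continuous_map Y X q"
    using q by (rule quotient_imp_continuous_map)
  obtain U L where U: "\<And>n::nat. openin Y (U n)" and L: "\<And>n. compactin Y (L n)"
    and UL: "\<And>n. U n \<subseteq> L n" and cover: "(\<Union>n. U n) = topspace Y"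
    using locally_compact_sigma_compact_cover[OF Y] by metis
  define K where "K n = (\<Union>i\<le>n. q ` L i)" for n :: nat
  have K: "compactin X (K n)" for n
    unfolding K_def by (intro compactin_Union) (auto intro: image_compactin[OF L cq])
  have mono: "incseq K"
    unfolding K_def by (rule incseq_SucI) (auto simp: atMost_Suc)
  have LK: "q ` U n \<subseteq> K n" for n
  proof -
    have "q ` L n \<subseteq> K n"
      unfolding K_def by auto
    with UL[of n] show ?thesis
      by auto
  qed
  have KX: "K n \<subseteq> topspace X" for n
    using K compactin_subset_topspace by auto
  have "topspace X = (\<Union>n. q ` U n)"
    using q cover by (simp add: quotient_imp_surjective_map flip: image_UN)
  also have "\<dots> \<subseteq> (\<Union>n. K n)"
    using LK by (intro SUP_mono) auto
  finally have KU: "(\<Union>n. K n) = topspace X"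
    using KX by (intro equalityI UN_least) auto
  \<comment> \<open>On \<open>U n\<close> the preimage of \<open>D\<close> coincides with that of
    the finite, hence closed, set \<open>D \<inter> K n\<close>; the quotient map then transfers
    closedness to \<open>D\<close>.\<close>
  have closed: "closedin X D" if D: "D \<subseteq> topspace X" "\<And>n. finite (D \<inter> K n)" for D
  proof -
    let ?A = "{y \<in> topspace Y. q y \<in> D}"
    have "\<exists>T. openin Y T \<and> y \<in> T \<and> T \<subseteq> topspace Y - ?A" if y: "y \<in> topspace Y - ?A" for y
    proof -
      have "y \<in> (\<Union>n. U n)"
        using y cover by simp
      then obtain n where n: "y \<in> U n"
        by auto
      let ?B = "{y \<in> topspace Y. q y \<in> D \<inter> K n}"
      have "closedin X (D \<inter> K n)"
        using D HX by (intro closedin_Hausdorff_finite) auto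
      then have "closedin Y ?B"
        using cq by (rule closedin_continuous_map_preimage[rotated])
      then have "openin Y (U n - ?B)"
        using U by (intro openin_diff)
      moreover have "U n - ?B \<subseteq> topspace Y - ?A"
        using LK[of n] openin_subset[OF U[of n]] by auto
      ultimately show ?thesis
        using n y by (intro exI[of _ "U n - ?B"]) auto
    qed
    then have "openin Y (topspace Y - ?A)"
      by (subst openin_subopen) (intro ballI)
    then have "closedin Y ?A"
      by (auto simp: closedin_def)
    then show ?thesis
      using q D(1) by (simp add: quotient_map_closedin)
  qed
  have "\<exists>n. C \<subseteq> K n" if C: "compactin X C" for C
  proof (rule ccontr)
    assume "\<not> ?thesis"
    then have "\<forall>n. \<exists>y. y \<in> C - K n"
      by auto
    then obtain x where x: "\<And>n. x n \<in> C - K n"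
      by metis
    have sub: "range x \<subseteq> topspace X"
      using x compactin_subset_topspace[OF C] by auto
    have fin: "finite (range x \<inter> K n)" for n
    proof -
      have "m < n" if "x m \<in> K n" for m
        using that x[of m] incseqD[OF mono, of n m] by (auto simp: not_less[symmetric])
      then have "range x \<inter> K n \<subseteq> x ` {..<n}"
        by auto
      then show ?thesis
        by (rule finite_subset) simp
    qed
    \<comment> \<open>A finite range would lie in the single set \<open>K ?M\<close>, against the
      choice of \<open>x ?M\<close>.\<close>
    have "infinite (range x)"
    proof
      assume *: "finite (range x)"
      have "\<exists>n. y \<in> K n" if "y \<in> range x" for y
      proof -
        have "y \<in> (\<Union>n. K n)"
          using that sub KU by auto
        then show ?thesis
          by auto
      qed
      then obtain m where m: "\<And>y. y \<in> range x \<Longrightarrow> y \<in> K (m y)"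
        by metis
      let ?M = "Max (m ` range x)"
      have "x ?M \<in> K (m (x ?M))"
        using m by simp
      moreover have "m (x ?M) \<le> ?M"
        using * by (intro Max_ge) auto
      ultimately show False
        using x[of ?M] incseqD[OF mono] by auto
    qed
    moreover have "range x \<subseteq> C"
      using x by auto
    ultimately have "C \<inter> X derived_set_of range x \<noteq> {}"
      by (intro compactin_imp_Bolzano_Weierstrass[OF C]) auto
    then obtain y where y: "y \<in> X derived_set_of range x"
      by auto
    \<comment> \<open>The accumulation point \<open>y\<close> may itself be a term. The other terms
      still form a closed set, whose complement is a neighbourhood of \<open>y\<close> containing
      none of them.\<close>
    have "finite ((range x - {y}) \<inter> K n)" for n
      using fin[of n] by (rule rev_finite_subset) auto
    then have "closedin X (range x - {y})"
      using sub by (intro closed) auto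
    then have "openin X (topspace X - (range x - {y}))"
      by (simp add: closedin_def)
    moreover have "y \<in> topspace X - (range x - {y})"
      using y by (simp add: in_derived_set_of)
    ultimately obtain z where "z \<noteq> y" "z \<in> range x" "z \<in> topspace X - (range x - {y})"
      using y unfolding in_derived_set_of by meson
    then show False
      by simp
  qed
  with K mono KU show thesis
    by (rule that)
qed

subsection \<open>Compact sequential spaces under CH\<close>

text \<open>A set of naturals codes a sequence of such sets, read off as its rows.\<close>

definition row :: "nat set \<Rightarrow> nat \<Rightarrow> nat set" where
  "row A n = {m. prod_encode (n, m) \<in> A}"

text \<open>Rows 0 and 1 carry parameters and the later rows a sequence, so one set of naturals
  codes countably many such sets: the continuum equals its own countable power.\<close>

lemma ex_row_eq:
  obtains A where "row A 0 = a" "row A 1 = b" "\<And>n. row A (n + 2) = s n"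
proof -
  define t where "t n = (if n = 0 then a else if n = 1 then b else s (n - 2))" for n
  define A where "A = {k. snd (prod_decode k) \<in> t (fst (prod_decode k))}"
  have "row A n = t n" for n
    by (simp add: row_def A_def)
  then show thesis
    by (intro that[of A]) (simp_all add: t_def)
qed

section \<open>An order of type \<open>\<omega>\<^sub>1\<close> on the continuum\<close>

lemma uncountable_nat_sets: "uncountable (UNIV :: nat set set)"
  using nat_sets_eqpoll_reals uncountable_UNIV_real by (metis countable_eqpoll eqpoll_sym)

text \<open>The type \<open>nat set\<close> stands for the continuum. It is uncountable, so a
  well-order on it with countable initial segments has type \<open>\<omega>\<^sub>1\<close>. Its
  elements serve both as ordinals and as codes of countable data.\<close>

locale omega1_order =
  fixes R :: "(nat set \<times> nat set) set"
  assumes wf: "wf R"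
    and trans: "(a, b) \<in> R \<Longrightarrow> (b, c) \<in> R \<Longrightarrow> (a, c) \<in> R"
    and total: "a \<noteq> b \<Longrightarrow> (a, b) \<in> R \<or> (b, a) \<in> R"
    and countable_below: "countable {b. (b, a) \<in> R}"

text \<open>A well-order of least possible type on the continuum has initial segments of smaller
  cardinality, which CH makes countable.\<close>

lemma continuum_hypothesis_imp_omega1_order:
  assumes continuum_hypothesis
  shows "\<exists>R. omega1_order R"
proof -
  let ?r = "card_of (UNIV :: nat set set)"
  have lin: "linear_order_on UNIV ?r" and wf: "wf (?r - Id)"
    using card_of_well_order_on[of "UNIV :: nat set set"] by (auto simp: well_order_on_def)
  then have tr: "trans (?r - Id)" and tot: "total_on UNIV ?r"
    by (auto simp: order_on_defs intro: trans_diff_Id)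
  have "countable (underS ?r a)" for a
  proof (rule ccontr)
    assume unc: "uncountable (underS ?r a)"
    \<comment> \<open>CH is formulated for sets of reals, so the segment is carried over by a
      bijection.\<close>
    obtain g :: "nat set \<Rightarrow> real" where g: "bij g"
      using nat_sets_eqpoll_reals by (auto simp: eqpoll_def)
    then have inj: "inj_on g (underS ?r a)"
      by (meson bij_is_inj inj_on_subset subset_UNIV)
    then have "uncountable (g ` underS ?r a)"
      using unc countable_image_inj_on by blast
    then have "g ` underS ?r a \<approx> (UNIV :: real set)"
      using assms unfolding continuum_hypothesis_def by blast
    then have "underS ?r a \<approx> (UNIV :: nat set set)"
      using inj_on_image_eqpoll_self[OF inj] nat_sets_eqpoll_reals eqpoll_sym eqpoll_trans by meson
    then have "(card_of (underS ?r a), ?r) \<in> ordIso"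
      using card_of_ordIso by (auto simp: eqpoll_def)
    moreover have "(card_of (underS ?r a), ?r) \<in> ordLess"
      by (rule card_of_underS[OF card_of_Card_order]) (simp add: Field_card_of)
    ultimately show False
      using not_ordLess_ordIso by blast
  qed
  then have "countable {b. (b, a) \<in> ?r - Id}" for a
    by (simp add: underS_def conj_commute)
  then have "omega1_order (?r - Id)"
    using wf tr tot by unfold_locales (auto simp: total_on_def dest: transD)
  then show ?thesis ..
qed

section \<open>Sequential hulls of size continuum and Cech-Pospisil trees\<close>

lemma (in omega1_order) sequentially_closed_hull:
  fixes \<pi> :: "nat set \<Rightarrow> 'a"
  assumes Z: "Hausdorff_space Z" and \<pi>: "range \<pi> \<subseteq> topspace Z"
  obtains h :: "nat set \<Rightarrow> 'a" where "range \<pi> \<subseteq> range h" "sequentially_closedin Z (range h)"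
proof -
  \<comment> \<open>Stage \<open>\<alpha>\<close> adds either a point of \<open>range \<pi>\<close> or, if row 0 is empty, the limit of the sequence
    of earlier points that \<open>\<alpha>\<close> codes. Each sequence of indices is coded by uncountably many \<open>\<alpha>\<close>,
    hence by one lying above all its terms.\<close>
  define F where "F g \<alpha> =
      (if row \<alpha> 0 = {} \<and> (\<forall>n. (row \<alpha> (n + 2), \<alpha>) \<in> R) \<and> (\<exists>l. limitin Z (\<lambda>n. g (row \<alpha> (n + 2))) l sequentially)
       then SOME l. limitin Z (\<lambda>n. g (row \<alpha> (n + 2))) l sequentially else \<pi> (row \<alpha> 1))"
    for g :: "nat set \<Rightarrow> 'a" and \<alpha>
  define h where "h = wfrec R F"
  \<comment> \<open>Values at the coded indices matter only if all of these precede
    \<open>\<alpha>\<close>, and there the restriction \<open>cut\<close> agrees with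
    \<open>h\<close>.\<close>
  have F_cut: "F (cut h R \<alpha>) \<alpha> = F h \<alpha>" for \<alpha>
  proof (cases "\<forall>n. (row \<alpha> (n + 2), \<alpha>) \<in> R")
    case True
    then have "(\<lambda>n. cut h R \<alpha> (row \<alpha> (n + 2))) = (\<lambda>n. h (row \<alpha> (n + 2)))"
      by (auto simp: cut_apply)
    then show ?thesis
      unfolding F_def by (simp only:)
  next
    case False
    then show ?thesis
      unfolding F_def by (simp only: simp_thms if_False)
  qed
  have h: "h \<alpha> = F h \<alpha>" for \<alpha>
    using wfrec[OF wf, of F \<alpha>] F_cut unfolding h_def by simp
  have \<pi>Z: "\<pi> \<gamma> \<in> topspace Z" for \<gamma>
    using \<pi> by auto
  have hZ: "h \<alpha> \<in> topspace Z" for \<alpha>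
  proof (cases "row \<alpha> 0 = {} \<and> (\<forall>n. (row \<alpha> (n + 2), \<alpha>) \<in> R) \<and> (\<exists>l. limitin Z (\<lambda>n. h (row \<alpha> (n + 2))) l sequentially)")
    case True
    then have "limitin Z (\<lambda>n. h (row \<alpha> (n + 2))) (h \<alpha>) sequentially"
      unfolding h[of \<alpha>] F_def by (simp only: if_True simp_thms) (auto intro: someI_ex)
    then show ?thesis
      by (rule limitin_topspace)
  next
    case False
    then show ?thesis
      unfolding h[of \<alpha>] F_def using \<pi>Z by (simp only: if_False)
  qed
  show thesis
  proof
    show "range \<pi> \<subseteq> range h"
    proof clarify
      fix \<gamma>
      \<comment> \<open>Any nonempty row 0 selects the branch that copies
        \<open>\<pi>\<close>.\<close>
      obtain \<alpha> where "row \<alpha> 0 = UNIV" "row \<alpha> 1 = \<gamma>"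
        using ex_row_eq by metis
      then have "h \<alpha> = \<pi> \<gamma>"
        by (simp add: h[of \<alpha>] F_def)
      then show "\<pi> \<gamma> \<in> range h"
        by (metis rangeI)
    qed
    show "sequentially_closedin Z (range h)"
      unfolding sequentially_closedin_def
    proof (intro conjI allI impI)
      show "range h \<subseteq> topspace Z"
        using hZ by auto
      fix \<sigma> l
      assume \<sigma>: "range \<sigma> \<subseteq> range h \<and> limitin Z \<sigma> l sequentially"
      have "\<exists>b. \<sigma> n = h b" for n
        using \<sigma> rangeI[of \<sigma> n] by (auto dest!: subsetD)
      then obtain \<beta> where \<beta>: "\<And>n. \<sigma> n = h (\<beta> n)"
        by metis
      then have \<sigma>_eq: "\<sigma> = (\<lambda>n. h (\<beta> n))"
        by (intro ext)
      \<comment> \<open>Row 1 is left free, which makes the set of codes of \<open>\<beta>\<close>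
        uncountable.\<close>
      define S where "S = {\<alpha>. row \<alpha> 0 = {} \<and> (\<forall>n. row \<alpha> (n + 2) = \<beta> n)}"
      have "\<gamma> \<in> (\<lambda>\<alpha>. row \<alpha> 1) ` S" for \<gamma>
      proof -
        obtain \<alpha> where "row \<alpha> 0 = {}" "row \<alpha> 1 = \<gamma>" "\<And>n. row \<alpha> (n + 2) = \<beta> n"
          using ex_row_eq[of "{}" \<gamma> \<beta>] by metis
        then show ?thesis
          unfolding S_def by (intro image_eqI[of _ _ \<alpha>]) auto
      qed
      then have "(\<lambda>\<alpha>. row \<alpha> 1) ` S = UNIV"
        by auto
      then have unc: "uncountable S"
        using uncountable_nat_sets countable_image[of S "\<lambda>\<alpha>. row \<alpha> 1"] by auto
      define B where "B n = insert (\<beta> n) {\<alpha>. (\<alpha>, \<beta> n) \<in> R}" for n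
      have "countable (\<Union>n. B n)"
        unfolding B_def by (intro countable_UN countable_insert countable_below) auto
      then have "\<not> S \<subseteq> (\<Union>n. B n)"
        using unc countable_subset by auto
      then obtain \<alpha> where \<alpha>: "\<alpha> \<in> S" "\<And>n. \<alpha> \<notin> B n"
        by auto
      have below: "\<forall>n. (\<beta> n, \<alpha>) \<in> R"
      proof
        fix n
        show "(\<beta> n, \<alpha>) \<in> R"
          using \<alpha>(2)[of n] total[of \<alpha> "\<beta> n"] unfolding B_def insert_iff mem_Collect_eq by meson
      qed
      have "limitin Z (\<lambda>n. h (\<beta> n)) l sequentially"
        using \<sigma> unfolding \<sigma>_eq by simp
      moreover from this have "h \<alpha> = (SOME l. limitin Z (\<lambda>n. h (\<beta> n)) l sequentially)"
        unfolding h[of \<alpha>] F_def using below \<alpha>(1) by (auto simp: S_def)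
      ultimately have "limitin Z (\<lambda>n. h (\<beta> n)) (h \<alpha>) sequentially"
        by (metis someI_ex)
      then have "h \<alpha> = l"
        using \<open>limitin Z (\<lambda>n. h (\<beta> n)) l sequentially\<close>
        by (rule limitin_Hausdorff_unique[OF _ _ trivial_limit_sequentially Z])
      then show "l \<in> range h"
        by auto
    qed
  qed
qed

text \<open>A set \<open>f\<close> of indices is a branch: whether \<open>\<alpha> \<in> f\<close>
  selects one of two disjoint members of \<open>W\<close> inside the intersection of everything
  chosen earlier. Initial segments are countable, so \<open>chain\<close> keeps these intersections
  in \<open>W\<close>.\<close>

lemma (in omega1_order) cech_pospisil_tree:
  fixes W :: "'a set set"
  assumes F0: "F0 \<in> W"
    and split: "\<And>F. F \<in> W \<Longrightarrow> \<exists>A\<in>W. \<exists>B\<in>W. A \<subseteq> F \<and> B \<subseteq> F \<and> A \<inter> B = {}"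
    and chain: "\<And>\<C>. countable \<C> \<Longrightarrow> \<C> \<noteq> {} \<Longrightarrow> \<C> \<subseteq> W \<Longrightarrow> chain_subset \<C> \<Longrightarrow> \<Inter>\<C> \<in> W"
  obtains H :: "nat set set \<Rightarrow> nat set \<Rightarrow> 'a set" where
    "\<And>f \<alpha>. H f \<alpha> \<in> W"
    "\<And>f \<alpha> \<beta>. (\<beta>, \<alpha>) \<in> R \<Longrightarrow> H f \<alpha> \<subseteq> H f \<beta>"
    "\<And>f g \<alpha>. f \<inter> insert \<alpha> {\<beta>. (\<beta>, \<alpha>) \<in> R} = g \<inter> insert \<alpha> {\<beta>. (\<beta>, \<alpha>) \<in> R} \<Longrightarrow> H f \<alpha> = H g \<alpha>"
    "\<And>f g. f \<noteq> g \<Longrightarrow> \<exists>\<alpha>. H f \<alpha> \<inter> H g \<alpha> = {}"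
proof -
  have "\<forall>F. \<exists>A B. F \<in> W \<longrightarrow> A \<in> W \<and> B \<in> W \<and> A \<subseteq> F \<and> B \<subseteq> F \<and> A \<inter> B = {}"
    using split by meson
  then obtain A B where AB: "\<And>F. F \<in> W \<Longrightarrow> A F \<in> W \<and> B F \<in> W \<and> A F \<subseteq> F \<and> B F \<subseteq> F \<and> A F \<inter> B F = {}"
    by metis
  define S where "S F b = (if b then A F else B F)" for F b
  have S: "S F b \<in> W" "S F b \<subseteq> F" if "F \<in> W" for F b
    using AB[OF that] by (auto simp: S_def)
  \<comment> \<open>\<open>F0\<close> is the root of the tree and keeps the family nonempty at the
    least index.\<close>
  define H where "H f = wfrec R (\<lambda>h \<alpha>. S (\<Inter>(insert F0 (h ` {\<beta>. (\<beta>, \<alpha>) \<in> R}))) (\<alpha> \<in> f))" for f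
  \<comment> \<open>This is the node before the split at \<open>\<alpha>\<close>; it depends only on
    the part of \<open>f\<close> strictly below \<open>\<alpha>\<close>.\<close>
  define G where "G f \<alpha> = \<Inter>(insert F0 (H f ` {\<beta>. (\<beta>, \<alpha>) \<in> R}))" for f \<alpha>
  have H: "H f \<alpha> = S (G f \<alpha>) (\<alpha> \<in> f)" for f \<alpha>
  proof -
    have "cut (H f) R \<alpha> ` {\<beta>. (\<beta>, \<alpha>) \<in> R} = H f ` {\<beta>. (\<beta>, \<alpha>) \<in> R}"
      by (intro image_cong) (auto simp: cut_apply)
    moreover have "H f \<alpha> = S (\<Inter>(insert F0 (cut (H f) R \<alpha> ` {\<beta>. (\<beta>, \<alpha>) \<in> R}))) (\<alpha> \<in> f)"
      unfolding H_def by (rule wfrec[OF wf])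
    ultimately show ?thesis
      unfolding G_def by simp
  qed
  have GW: "G f \<alpha> \<in> W" for f \<alpha>
    using wf
  proof (induction \<alpha> rule: wf_induct_rule)
    case (less \<alpha>)
    have sub: "H f \<beta> \<in> W" "H f \<beta> \<subseteq> G f \<beta>" if "(\<beta>, \<alpha>) \<in> R" for \<beta>
      using S[OF less[OF that]] H by auto
    have F0_sup: "H f \<beta> \<subseteq> F0" if "(\<beta>, \<alpha>) \<in> R" for \<beta>
      using sub(2)[OF that] by (auto simp: G_def)
    have dec: "H f \<gamma> \<subseteq> H f \<beta>" if "(\<beta>, \<gamma>) \<in> R" "(\<gamma>, \<alpha>) \<in> R" for \<beta> \<gamma>
      using sub(2)[OF that(2)] that(1) by (auto simp: G_def)
    show ?case
      unfolding G_def
    proof (rule chain)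
      show "countable (insert F0 (H f ` {\<beta>. (\<beta>, \<alpha>) \<in> R}))"
        using countable_below by auto
      show "insert F0 (H f ` {\<beta>. (\<beta>, \<alpha>) \<in> R}) \<subseteq> W"
        using F0 sub(1) by auto
      have "C \<subseteq> D \<or> D \<subseteq> C" if "C \<in> insert F0 (H f ` {\<beta>. (\<beta>, \<alpha>) \<in> R})" "D \<in> insert F0 (H f ` {\<beta>. (\<beta>, \<alpha>) \<in> R})" for C D
      proof -
        from that consider "C = F0" "D \<subseteq> F0" | "D = F0" "C \<subseteq> F0"
          | \<beta> \<gamma> where "C = H f \<beta>" "D = H f \<gamma>" "(\<beta>, \<alpha>) \<in> R" "(\<gamma>, \<alpha>) \<in> R"
          using F0_sup by auto
        then show ?thesis
        proof cases
          case 3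
          then show ?thesis
            using total[of \<beta> \<gamma>] dec[of \<beta> \<gamma>] dec[of \<gamma> \<beta>] by (cases "\<beta> = \<gamma>") auto
        qed auto
      qed
      then show "chain_subset (insert F0 (H f ` {\<beta>. (\<beta>, \<alpha>) \<in> R}))"
        by (simp only: chain_subset_def) blast
    qed auto
  qed
  have agree_G: "G f \<alpha> = G g \<alpha>" if "f \<inter> {\<beta>. (\<beta>, \<alpha>) \<in> R} = g \<inter> {\<beta>. (\<beta>, \<alpha>) \<in> R}" for f g \<alpha>
    using wf that
  proof (induction \<alpha> rule: wf_induct_rule)
    case (less \<alpha>)
    have "H f \<beta> = H g \<beta>" if \<beta>: "(\<beta>, \<alpha>) \<in> R" for \<beta>
    proof -
      have "f \<inter> {\<gamma>. (\<gamma>, \<beta>) \<in> R} = g \<inter> {\<gamma>. (\<gamma>, \<beta>) \<in> R}"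
        using less.prems trans[OF _ \<beta>] by blast
      moreover have "\<beta> \<in> f \<longleftrightarrow> \<beta> \<in> g"
        using less.prems \<beta> by blast
      ultimately show ?thesis
        using less.IH[OF \<beta>] by (simp add: H)
    qed
    then show ?case
      unfolding G_def by (metis (mono_tags, lifting) image_cong mem_Collect_eq)
  qed
  show thesis
  proof
    show "H f \<alpha> \<in> W" for f \<alpha>
      unfolding H using GW S by auto
    show "H f \<alpha> \<subseteq> H f \<beta>" if "(\<beta>, \<alpha>) \<in> R" for f \<alpha> \<beta>
    proof -
      have "H f \<alpha> \<subseteq> G f \<alpha>"
        unfolding H using GW S by auto
      also have "\<dots> \<subseteq> H f \<beta>"
        using that by (auto simp: G_def)
      finally show ?thesis .
    qed
    show "H f \<alpha> = H g \<alpha>"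
      if "f \<inter> insert \<alpha> {\<beta>. (\<beta>, \<alpha>) \<in> R} = g \<inter> insert \<alpha> {\<beta>. (\<beta>, \<alpha>) \<in> R}" for f g \<alpha>
    proof -
      have "f \<inter> {\<beta>. (\<beta>, \<alpha>) \<in> R} = g \<inter> {\<beta>. (\<beta>, \<alpha>) \<in> R}" "\<alpha> \<in> f \<longleftrightarrow> \<alpha> \<in> g"
        using that by blast+
      from agree_G[OF this(1)] this(2) show ?thesis
        by (simp only: H)
    qed
    show "\<exists>\<alpha>. H f \<alpha> \<inter> H g \<alpha> = {}" if "f \<noteq> g" for f g
    proof -
      \<comment> \<open>At the least index where \<open>f\<close> and \<open>g\<close> differ, they
        take different halves of the same set.\<close>
      have "\<exists>\<alpha>. \<alpha> \<in> {\<alpha>. (\<alpha> \<in> f) \<noteq> (\<alpha> \<in> g)}"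
        using that by auto
      then obtain \<alpha> where \<alpha>: "(\<alpha> \<in> f) \<noteq> (\<alpha> \<in> g)" "\<And>\<beta>. (\<beta>, \<alpha>) \<in> R \<Longrightarrow> (\<beta> \<in> f) = (\<beta> \<in> g)"
        using wfE_min'[OF wf, of "{\<alpha>. (\<alpha> \<in> f) \<noteq> (\<alpha> \<in> g)}"] by auto
      then have "G f \<alpha> = G g \<alpha>"
        by (intro agree_G) auto
      then have "H f \<alpha> \<inter> H g \<alpha> = {}"
        using \<alpha>(1) AB[OF GW[of g \<alpha>]] by (auto simp: H S_def)
      then show ?thesis ..
    qed
  qed
qed

text \<open>The nodes of the tree are indexed by countable data, so one point from each node makes only
  continuum many points, and so does their sequential closure. Every one of the
  \<open>2\<close>-to-the-continuum branches contains a point of that closure, and different branches are disjoint.\<close>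

lemma (in omega1_order) no_splitting_family:
  fixes Z :: "'a topology"
  assumes Z: "compact_space Z" "Hausdorff_space Z" "sequential_space Z"
    and F0: "F0 \<in> W"
    and W: "\<And>F. F \<in> W \<Longrightarrow> closedin Z F \<and> F \<noteq> {}"
    and split: "\<And>F. F \<in> W \<Longrightarrow> \<exists>A\<in>W. \<exists>B\<in>W. A \<subseteq> F \<and> B \<subseteq> F \<and> A \<inter> B = {}"
    and chain: "\<And>\<C>. countable \<C> \<Longrightarrow> \<C> \<noteq> {} \<Longrightarrow> \<C> \<subseteq> W \<Longrightarrow> chain_subset \<C> \<Longrightarrow> \<Inter>\<C> \<in> W"
  shows False
proof (rule cech_pospisil_tree[OF F0 split chain])
  fix H :: "nat set set \<Rightarrow> nat set \<Rightarrow> 'a set"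
  assume HW: "\<And>f \<alpha>. H f \<alpha> \<in> W"
    and dec: "\<And>f \<alpha> \<beta>. (\<beta>, \<alpha>) \<in> R \<Longrightarrow> H f \<alpha> \<subseteq> H f \<beta>"
    and agree: "\<And>f g \<alpha>. f \<inter> insert \<alpha> {\<beta>. (\<beta>, \<alpha>) \<in> R} = g \<inter> insert \<alpha> {\<beta>. (\<beta>, \<alpha>) \<in> R} \<Longrightarrow> H f \<alpha> = H g \<alpha>"
    and disj: "\<And>f g. f \<noteq> g \<Longrightarrow> \<exists>\<alpha>. H f \<alpha> \<inter> H g \<alpha> = {}"
  define pt where "pt f \<alpha> = (SOME x. x \<in> H f \<alpha>)" for f \<alpha>
  have pt: "pt f \<alpha> \<in> H f \<alpha>" for f \<alpha>
    unfolding pt_def some_in_eq using W[OF HW] by (rule conjunct2)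
  have HZ: "H f \<alpha> \<subseteq> topspace Z" for f \<alpha>
    using W[OF HW, THEN conjunct1] by (rule closedin_subset)
  \<comment> \<open>Row 0 is the index of the node, and the rows \<open>n + 2\<close> with
    \<open>n\<close> in row 1 list a countable set. Selecting positions by row 1 admits the empty
    set as well.\<close>
  define \<pi> where "\<pi> A = pt {row A (n + 2) | n. n \<in> row A 1} (row A 0)" for A
  have pt_in: "pt f \<alpha> \<in> range \<pi>" for f \<alpha>
  proof -
    \<comment> \<open>The node at \<open>\<alpha>\<close> is determined by this countable part of
      \<open>f\<close>, which a single \<open>A\<close> can code.\<close>
    let ?B = "f \<inter> insert \<alpha> {\<beta>. (\<beta>, \<alpha>) \<in> R}"
    have "countable ?B"
      by (intro countable_Int2 countable_insert countable_below)
    then obtain s and N :: "nat set" where s: "?B = s ` N"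
      unfolding countable_as_injective_image_subset by auto
    obtain A where A: "row A 0 = \<alpha>" "row A 1 = N" "\<And>n. row A (n + 2) = s n"
      using ex_row_eq[of \<alpha> N s] by metis
    have "{row A (n + 2) | n. n \<in> row A 1} = ?B"
      unfolding A s by (simp only: image_def Bex_def) (simp add: conj_commute)
    then have "\<pi> A = pt ?B \<alpha>"
      unfolding \<pi>_def A(1) by (rule arg_cong)
    moreover have "H ?B \<alpha> = H f \<alpha>"
      by (rule agree) auto
    \<comment> \<open>\<open>pt\<close> is chosen from the node alone, so equal nodes give the same
      point.\<close>
    ultimately have "\<pi> A = pt f \<alpha>"
      by (simp only: pt_def)
    then show ?thesis
      by (rule range_eqI[OF sym])
  qed
  have "\<pi> A \<in> topspace Z" for A
    unfolding \<pi>_def using pt HZ by (rule subsetD[rotated])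
  then have "range \<pi> \<subseteq> topspace Z"
    by auto
  then obtain h :: "nat set \<Rightarrow> 'a" where h: "range \<pi> \<subseteq> range h" "sequentially_closedin Z (range h)"
    using sequentially_closed_hull[OF Z(2)] by blast
  then have h_closed: "closedin Z (range h)"
    using Z(3) by (simp add: sequential_space_def)
  have "\<exists>\<gamma>. \<forall>\<alpha>. h \<gamma> \<in> H f \<alpha>" for f
  proof -
    \<comment> \<open>The closure of the tail of chosen points from \<open>\<alpha>\<close> on stays
      inside \<open>H f \<alpha>\<close> and inside the closed set \<open>range h\<close>. These
      closures decrease, so compactness gives a common point, lying in every node of the branch and
      in the hull.\<close>
    define T where "T \<alpha> = Z closure_of (pt f ` insert \<alpha> {\<beta>. (\<alpha>, \<beta>) \<in> R})" for \<alpha>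
    have sub: "pt f ` insert \<alpha> {\<beta>. (\<alpha>, \<beta>) \<in> R} \<subseteq> H f \<alpha>" for \<alpha>
      using pt dec by blast
    have TH: "T \<alpha> \<subseteq> H f \<alpha>" for \<alpha>
      unfolding T_def using sub W[OF HW] by (intro closure_of_minimal) auto
    have Th: "T \<alpha> \<subseteq> range h" for \<alpha>
      unfolding T_def using pt_in h(1) h_closed by (intro closure_of_minimal) auto
    have Tne: "T \<alpha> \<noteq> {}" for \<alpha>
    proof -
      have "pt f ` insert \<alpha> {\<beta>. (\<alpha>, \<beta>) \<in> R} \<subseteq> T \<alpha>"
        unfolding T_def using sub[of \<alpha>] HZ[of f \<alpha>] by (intro closure_of_subset) auto
      then show ?thesis
        by auto
    qed
    have T_dec: "T \<alpha> \<subseteq> T \<beta>" if "(\<beta>, \<alpha>) \<in> R" for \<alpha> \<beta>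
      unfolding T_def using trans[OF that] that by (intro closure_of_mono image_mono) auto
    have "\<Inter>(range T) \<noteq> {}"
    proof (rule compact_space_chain_Inter_nonempty[OF Z(1)])
      fix F assume "F \<in> range T"
      then show "closedin Z F \<and> F \<noteq> {}"
        using Tne by (auto simp: T_def)
    next
      fix C D assume "C \<in> range T" "D \<in> range T"
      then obtain \<alpha> \<beta> where "C = T \<alpha>" "D = T \<beta>"
        by auto
      then show "C \<subseteq> D \<or> D \<subseteq> C"
        using total[of \<alpha> \<beta>] T_dec[of \<alpha> \<beta>] T_dec[of \<beta> \<alpha>] by (cases "\<alpha> = \<beta>") auto
    qed
    then obtain x where x: "\<And>\<alpha>. x \<in> T \<alpha>"
      by auto
    then obtain \<gamma> where "x = h \<gamma>"
      using Th by blast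
    then show ?thesis
      using x TH by blast
  qed
  then obtain c where c: "\<And>f \<alpha>. h (c f) \<in> H f \<alpha>"
    by metis
  \<comment> \<open>Different branches have no common point, so \<open>c\<close> would embed the
    power set of \<open>nat set\<close> into \<open>nat set\<close>.\<close>
  have "inj c"
  proof (rule injI, rule ccontr)
    fix f g assume "c f = c g" "f \<noteq> g"
    moreover obtain \<alpha> where "H f \<alpha> \<inter> H g \<alpha> = {}"
      using disj[OF \<open>f \<noteq> g\<close>] by blast
    ultimately show False
      using c[of f \<alpha>] c[of g \<alpha>] by auto
  qed
  then have "surj (inv c)"
    by (rule inj_imp_surj_inv)
  then have "inv c ` UNIV = Pow UNIV"
    by simp
  then show False
    using Cantors_theorem by metis
qed

text \<open>Without such a point no singleton in \<open>V\<close> is a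
  \<open>G\<^sub>\<delta>\<close>, so every nonempty closed \<open>G\<^sub>\<delta>\<close> inside
  \<open>V\<close> has two points and is split by level sets of a function separating them.
  Compactness keeps intersections of countable chains nonempty.\<close>

lemma compact_sequential_first_countable_point:
  assumes CH: continuum_hypothesis
    and Z: "compact_space Z" "Hausdorff_space Z" "sequential_space Z"
    and V: "openin Z V" "V \<noteq> {}"
  shows "\<exists>p\<in>V. first_countable_at Z p"
proof (rule ccontr)
  assume none: "\<not> ?thesis"
  obtain R where "omega1_order R"
    using continuum_hypothesis_imp_omega1_order[OF CH] ..
  then interpret omega1_order R .
  define W where "W = {F. closedin Z F \<and> gdelta_in Z F \<and> F \<noteq> {} \<and> F \<subseteq> V}"
  have no_singleton: "\<not> gdelta_in Z {p}" if "p \<in> V" for p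
    using none that gdelta_singleton_imp_first_countable_at[OF Z(1,2)] by auto
  have level: "closedin Z {x \<in> topspace Z. f x = c}" if "continuous_map Z euclideanreal f" for f c
    using closedin_continuous_map_preimage[OF that, of "{c}"] by simp
  obtain p where p: "p \<in> V"
    using V by auto
  obtain f where f: "continuous_map Z euclideanreal f" "f p = 0" "\<And>x. x \<in> topspace Z - V \<Longrightarrow> f x = 1"
    using compact_Hausdorff_separate_by_function[OF Z(1,2) V(1) p] by metis
  have "{x \<in> topspace Z. f x = 0} \<in> W"
  proof -
    have "x \<in> V" if "x \<in> topspace Z" "f x = 0" for x
      using f(3)[of x] that by auto
    moreover have "p \<in> {x \<in> topspace Z. f x = 0}"
      using p f(2) openin_subset[OF V(1)] by auto
    ultimately show ?thesis
      unfolding W_def using level[OF f(1)] gdelta_in_level_set[OF f(1)] by auto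
  qed
  then show False
  proof (rule no_splitting_family[OF Z])
    show "closedin Z F \<and> F \<noteq> {}" if "F \<in> W" for F
      using that by (simp add: W_def)
  next
    fix F assume F: "F \<in> W"
    then obtain x where x: "x \<in> F"
      by (auto simp: W_def)
    have "F \<noteq> {x}"
      using F no_singleton[of x] by (auto simp: W_def)
    then obtain y where y: "y \<in> F" "y \<noteq> x"
      using x by auto
    have FZ: "F \<subseteq> topspace Z"
      using F closedin_subset by (auto simp: W_def)
    have "openin Z (topspace Z - {y})" "x \<in> topspace Z - {y}"
      using Z(2) x y FZ by (auto intro!: openin_diff closedin_Hausdorff_finite)
    then obtain g where g: "continuous_map Z euclideanreal g" "g x = 0" "\<And>z. z \<in> topspace Z - (topspace Z - {y}) \<Longrightarrow> g z = 1"
      using compact_Hausdorff_separate_by_function[OF Z(1,2)] by metis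
    have gy: "g y = 1"
      using g(3)[of y] y FZ by auto
    have in_W: "F \<inter> {z \<in> topspace Z. g z = g w} \<in> W" if "w \<in> F" for w
      using F FZ that level[OF g(1)] gdelta_in_level_set[OF g(1)]
      by (auto simp: W_def intro!: closedin_Int gdelta_in_Int)
    show "\<exists>A\<in>W. \<exists>B\<in>W. A \<subseteq> F \<and> B \<subseteq> F \<and> A \<inter> B = {}"
      using in_W[OF x] in_W[OF y(1)] g(2) gy
      by (intro bexI[of _ "F \<inter> {z \<in> topspace Z. g z = g x}"] bexI[of _ "F \<inter> {z \<in> topspace Z. g z = g y}"]) auto
  next
    fix \<C>
    assume \<C>: "countable \<C>" "\<C> \<noteq> {}" "\<C> \<subseteq> W" "chain_subset \<C>"
    have mem: "closedin Z F" "gdelta_in Z F" "F \<noteq> {}" "F \<subseteq> V" if "F \<in> \<C>" for F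
      using \<C>(3) that by (auto simp: W_def)
    have "\<Inter>\<C> \<noteq> {}"
      using mem \<C>(4) by (intro compact_space_chain_Inter_nonempty[OF Z(1)]) (auto simp: chain_subset_def)
    moreover have "closedin Z (\<Inter>\<C>)"
      using mem \<C>(2) by (intro closedin_Inter) auto
    moreover have "gdelta_in Z (\<Inter>\<C>)"
      using mem \<C>(1,2) by (intro gdelta_in_Inter) auto
    moreover have "\<Inter>\<C> \<subseteq> V"
      using mem(4) \<C>(2) by (intro Inf_less_eq) auto
    ultimately show "\<Inter>\<C> \<in> W"
      by (simp add: W_def)
  qed
qed

subsection \<open>Points outside the interiors of the exhausting sets\<close>

lemma nowhere_dense_compacts_imp_non_k_points:
  assumes X: "Hausdorff_space X" "sequential_space X"
    and K: "incseq K" "(\<Union>n. K n) = topspace X" "\<And>C. compactin X C \<Longrightarrow> \<exists>n::nat. C \<subseteq> K n"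
    and U: "openin X U" "\<And>n. U \<inter> X interior_of (K n) = {}"
  shows "U \<subseteq> non_k_points X"
proof
  fix x assume xU: "x \<in> U"
  then have x: "x \<in> topspace X"
    using openin_subset[OF U(1)] by auto
  have not_sub: "\<not> T \<subseteq> K n" if "openin X T" "T \<subseteq> U" "T \<noteq> {}" for T n
    using interior_of_maximal[of T "K n" X] that U(2)[of n] by auto
  \<comment> \<open>Otherwise \<open>{x}\<close> would be an open subset of \<open>U\<close> inside
    some \<open>K n\<close>. The failure provides a sequence of points other than \<open>x\<close>
    whose limit can only be \<open>x\<close>.\<close>
  have "\<not> sequentially_closedin X (topspace X - {x})"
  proof
    assume "sequentially_closedin X (topspace X - {x})"
    then have "openin X {x}"
      using X(2) x by (auto simp: sequential_space_def closedin_def Diff_Diff_Int)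
    moreover obtain n where "x \<in> K n"
      using x K(2) by auto
    ultimately show False
      using not_sub[of "{x}" n] xU by auto
  qed
  then obtain \<sigma> l where \<sigma>l: "range \<sigma> \<subseteq> topspace X - {x}" "limitin X \<sigma> l sequentially" "l \<notin> topspace X - {x}"
    unfolding sequentially_closedin_def by auto
  moreover have "l \<in> topspace X"
    using \<sigma>l(2) by (rule limitin_topspace)
  ultimately have lim: "limitin X \<sigma> x sequentially"
    by auto
  have \<sigma>: "\<sigma> n \<in> topspace X" "\<sigma> n \<noteq> x" for n
    using \<sigma>l(1) by auto
  have "\<exists>P Q. openin X P \<and> openin X Q \<and> \<sigma> n \<in> P \<and> x \<in> Q \<and> disjnt P Q" for n
    using X(1) x \<sigma>[of n] by (simp add: Hausdorff_space_def)
  then obtain P Q where PQ: "\<And>n. openin X (P n) \<and> openin X (Q n) \<and> \<sigma> n \<in> P n \<and> x \<in> Q n \<and> disjnt (P n) (Q n)"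
    by metis
  \<comment> \<open>\<open>\<sigma> n\<close> is adherent to the \<open>n\<close>-th piece, but only the first \<open>m\<close> pieces meet \<open>K m\<close>,
    and \<open>x\<close> is adherent to none of them.\<close>
  define E where "E = (\<Union>n. U \<inter> P n - K n)"
  have EX: "E \<subseteq> topspace X"
    unfolding E_def using openin_subset[OF U(1)] by auto
  have "x \<in> X closure_of E"
    unfolding in_closure_of
  proof (intro conjI allI impI x)
    fix T assume T: "x \<in> T \<and> openin X T"
    then have "\<forall>\<^sub>F n in sequentially. \<sigma> n \<in> T \<inter> U"
      using lim xU U(1) unfolding limitin_def by (meson IntI openin_Int)
    then obtain n where n: "\<sigma> n \<in> T \<inter> U"
      using eventually_happens by force
    have "openin X (T \<inter> U \<inter> P n)"
      using T U(1) PQ[of n] by auto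
    then have "\<not> T \<inter> U \<inter> P n \<subseteq> K n"
      using n PQ[of n] by (intro not_sub) auto
    then obtain y where "y \<in> T \<inter> U \<inter> P n" "y \<notin> K n"
      by auto
    then show "\<exists>y. y \<in> E \<and> y \<in> T"
      unfolding E_def by (intro exI[of _ y]) auto
  qed
  moreover have "x \<notin> X closure_of (E \<inter> C)" if C: "compactin X C" for C
  proof
    assume cl: "x \<in> X closure_of (E \<inter> C)"
    obtain m where m: "C \<subseteq> K m"
      using K(3)[OF C] by auto
    \<comment> \<open>For \<open>m = 0\<close> the intersection of the \<open>Q n\<close> is
      \<open>UNIV\<close>; the factor \<open>topspace X\<close> makes \<open>O'\<close> open in that
      case too.\<close>
    define O' where "O' = topspace X \<inter> \<Inter>(Q ` {..<m})"
    have "openin X O'"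
      unfolding O'_def using PQ by (intro openin_Int_Inter) auto
    moreover have "x \<in> O'"
      unfolding O'_def using PQ x by auto
    ultimately obtain y where y: "y \<in> E" "y \<in> C" "y \<in> O'"
      using cl unfolding in_closure_of by auto
    then obtain n where n: "y \<in> P n" "y \<notin> K n"
      by (auto simp: E_def)
    then have "n < m"
      using m y(2) incseqD[OF K(1), of m n] by (auto simp: not_le[symmetric])
    then have "y \<in> Q n"
      using y(3) by (auto simp: O'_def)
    then show False
      using PQ[of n] n(1) by (auto simp: disjnt_iff)
  qed
  ultimately have "\<not> k_point X x"
    unfolding k_point_def using EX by auto
  then show "x \<in> non_k_points X"
    using x by (simp add: non_k_points_def)
qed

theorem theorem5p4:
  fixes X :: "'a topology"
  assumes "continuum_hypothesis"
    and "sequential_space X"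
    and "k_omega_space TYPE('b) X"
  shows "(\<exists>D \<subseteq> topspace X. X closure_of D = topspace X \<and> (\<forall>x \<in> D. first_countable_at X x))
         \<longleftrightarrow> X interior_of (non_k_points X) = {}"
proof
  assume "\<exists>D \<subseteq> topspace X. X closure_of D = topspace X \<and> (\<forall>x \<in> D. first_countable_at X x)"
  then obtain D where D: "X closure_of D = topspace X" "\<forall>x \<in> D. first_countable_at X x"
    by auto
  then have "D \<inter> non_k_points X = {}"
    using first_countable_at_imp_k_point[of X] by (auto simp: non_k_points_def)
  then have "D \<inter> X interior_of (non_k_points X) = {}"
    using interior_of_subset[of X "non_k_points X"] by auto
  \<comment> \<open>An open set that misses \<open>D\<close> also misses its closure, here the whole
    space.\<close>
  then have "X closure_of D \<inter> X interior_of (non_k_points X) = {}"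
    using openin_Int_closure_of_eq_empty[OF openin_interior_of[of X "non_k_points X"], of D]
    by (simp add: Int_commute)
  then show "X interior_of (non_k_points X) = {}"
    using interior_of_subset_topspace[of X "non_k_points X"] by (auto simp: D(1))
next
  assume empty: "X interior_of (non_k_points X) = {}"
  obtain K where K: "\<And>n::nat. compactin X (K n)" "incseq K" "(\<Union>n. K n) = topspace X"
    "\<And>C. compactin X C \<Longrightarrow> \<exists>n. C \<subseteq> K n"
    using k_omega_space_hemicompact[OF assms(3)] by metis
  have X: "Hausdorff_space X"
    using assms(3) by (simp add: k_omega_space_def)
  let ?D = "{x \<in> topspace X. first_countable_at X x}"
  have "\<exists>p\<in>U. first_countable_at X p" if U: "openin X U" "U \<noteq> {}" for U
  proof -
    have "\<not> U \<subseteq> non_k_points X"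
      using interior_of_maximal[OF _ U(1)] empty U(2) by auto
    then obtain n where n: "U \<inter> X interior_of (K n) \<noteq> {}"
      using nowhere_dense_compacts_imp_non_k_points[OF X assms(2) K(2,3,4) U(1)] by auto
    \<comment> \<open>\<open>?V\<close> is open both in \<open>X\<close> and in the compact space
      \<open>?Z\<close>, so a point of first countability found in \<open>?Z\<close> is one in
      \<open>X\<close>.\<close>
    let ?V = "U \<inter> X interior_of (K n)" and ?Z = "subtopology X (K n)"
    have V: "openin X ?V" "?V \<subseteq> K n"
      using U(1) interior_of_subset[of X "K n"] by auto
    have "compact_space ?Z" "Hausdorff_space ?Z" "sequential_space ?Z"
      using K(1)[of n] X assms(2)
      by (auto simp: compact_space_subtopology Hausdorff_space_subtopology
          intro: sequential_space_closed_subtopology compactin_imp_closedin)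
    moreover have "openin ?Z ?V"
      using openin_subtopology_Int2[OF V(1), of "K n"] V(2) by (simp only: inf.absorb2)
    ultimately obtain p where "p \<in> ?V" "first_countable_at ?Z p"
      using compact_sequential_first_countable_point[OF assms(1) _ _ _ _ n] by meson
    then show ?thesis
      using first_countable_at_subtopology_imp[OF _ V] by auto
  qed
  then have "X closure_of ?D = topspace X"
    unfolding dense_intersects_open using openin_subset[of X] by fast
  then show "\<exists>D \<subseteq> topspace X. X closure_of D = topspace X \<and> (\<forall>x \<in> D. first_countable_at X x)"
    by (intro exI[of _ ?D]) auto
qed

end
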